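(* (1) The statistic $\mathrm{bk}_1$ (cardinality of the block containing $1$) is weakly shuffle-compatible on set partitions. (2) The linear map on $\mathcal{A}^{\Pi}_{\mathrm{bk}_1}$ defined by $[\pi]^\Pi_{\mathrm{bk}_1}\mapsto[f(\pi)]^{\mathrm{PF}}_{\mathrm{lel}}$, where $f:\Pi\to\mathrm{PF}$ sends a set partition $\pi$ to the parking function $(1)^{\mathrm{bk}_1(\pi)}\cdot(2)^{|\pi|-\mathrm{bk}_1(\pi)}$, is an algebra isomorphism between $\mathcal{A}^{\Pi}_{\mathrm{bk}_1}$ and $\mathcal{A}^{\mathrm{PF}}_{\mathrm{lel}}$.
   Context: All algebras are over $\mathbb{Q}$. $(a)^k$ denotes the word consisting of $k$ copies of $a$, and $\cdot$ is concatenation. Set partitions: $\Pi_n$ is the set of set partitions of $[n]=\{1,\dots,n\}$, and $\Pi=\bigcup_{n\ge0}\Pi_n$; $|\pi|=n$ for $\pi\in\Pi_n$. For $\pi$ a set partition of $\{i_1<\dots<i_n\}$ and $S=\{s_1<\dots<s_n\}$, $\mathrm{shift}_S(\pi)$ is the set partition of $S$ obtained by replacing each $i_j$ by $s_j$. For $\tau\in\Pi_n,\theta\in\Pi_m$, the shifted arc-shuffle is the multiset (indexed by $S$) $\overrightarrow{\mathrm{ASh}}(\tau,\theta)=\{\{\mathrm{shift}_S(\tau)\cup\mathrm{shift}_{[n+m]\setminus S}(\theta): S\subseteq[n+m],|S|=n\}\}$. $\mathrm{bk}_1(\pi)$ is the size of the block of $\pi$ containing $1$ (with value $0$ for the empty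 partition). A statistic $\mathrm{st}$ on $\Pi$ is weakly shuffle-compatible on set partitions if for all $\tau,\theta\in\Pi$ the multiset $\{\{\mathrm{st}(\pi):\pi\in\overrightarrow{\mathrm{ASh}}(\tau,\theta)\}\}$ is determined by $\mathrm{st}(\tau),\mathrm{st}(\theta),|\tau|,|\theta|$. With $[\pi]^\Pi_{\mathrm{st}}=\{\tau\in\Pi:\mathrm{st}(\tau)=\mathrm{st}(\pi),|\tau|=|\pi|\}$, $\mathcal{A}^\Pi_{\mathrm{st}}$ is the algebra with basis these classes and product $[\tau]^\Pi_{\mathrm{st}}[\theta]^\Pi_{\mathrm{st}}=\sum_{\pi\in\overrightarrow{\mathrm{ASh}}(\tau,\theta)}[\pi]^\Pi_{\mathrm{st}}$ (with multiplicity). Parking functions: $\mathrm{PF}$ is the set of sequences $\alpha=(\alpha_1,\dots,\alpha_n)$, $n\ge0$, of positive integers whose weakly increasing rearrangement satisfies $\alpha'_i\le i$; $|\alpha|=n$. $\mathrm{lel}(\alpha)=|\{i:\alpha_i=\alpha_1\}|$. For $\alpha,\beta\in\mathrm{PF}$ with $|\alpha|=n$, $\overrightarrow{\mathrm{Sh}}(\alpha,\beta)$ is the set of all interleavings of $\alpha$ with $\beta[n]$ ($\beta$ with $n$ added to each entry). With $[\alpha]^{\mathrm{PF}}_{\mathrm{lel}}=\{\beta\in\mathrm{PF}:\mathrm{lel}(\beta)=\mathrm{lel}(\alpha),|\beta|=|\alpha|\}$, $\mathcal{A}^{\mathrm{PF}}_{\mathrm{lel}}$ is the algebra with basis these classes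 and product $[\alpha]^{\mathrm{PF}}_{\mathrm{lel}}[\beta]^{\mathrm{PF}}_{\mathrm{lel}}=\sum_{\gamma\in\overrightarrow{\mathrm{Sh}}(\alpha,\beta)}[\gamma]^{\mathrm{PF}}_{\mathrm{lel}}$; this is well defined because $\mathrm{lel}$ is weakly shuffle-compatible on parking functions (i.e. the multiset of $\mathrm{lel}$ values over $\overrightarrow{\mathrm{Sh}}(\alpha,\beta)$ is determined by $\mathrm{lel}(\alpha),\mathrm{lel}(\beta),|\alpha|,|\beta|$). *)

theory Defs
  imports
    "HOL-Library.Disjoint_Sets"
    "HOL-Library.Multiset"
    "HOL-Library.Poly_Mapping"
    "HOL-Algebra.QuotRing"
    "HOL-Algebra.Module"
    "HOL-Algebra.Algebraic_Closure_Type"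
begin

section \<open>Shuffle-compatible statistics and their algebras\<close>

text \<open>
  Set partitions with the shifted arc-shuffle and parking functions with the shifted shuffle
  are both instances of the following data, so that weak shuffle-compatibility and the algebra
  of a statistic need to be defined only once.
\<close>

record 'a shuffle_family =
  objects :: "'a set"
  obj_size :: "'a \<Rightarrow> nat"
  obj_shuffle :: "'a \<Rightarrow> 'a \<Rightarrow> 'a multiset"
  empty_obj :: 'a

definition weakly_shuffle_compatible :: "'a shuffle_family \<Rightarrow> ('a \<Rightarrow> 's) \<Rightarrow> bool" where
  "weakly_shuffle_compatible F st \<longleftrightarrow>
     (\<forall>x\<in>objects F. \<forall>x'\<in>objects F. \<forall>y\<in>objects F. \<forall>y'\<in>objects F.
        st x = st x' \<and> st y = st y' \<and>
        obj_size F x = obj_size F x' \<and> obj_size F y = obj_size F y' \<longrightarrow>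
        image_mset st (obj_shuffle F x y) = image_mset st (obj_shuffle F x' y'))"

definition st_class :: "'a shuffle_family \<Rightarrow> ('a \<Rightarrow> 's) \<Rightarrow> 'a \<Rightarrow> 'a set" where
  "st_class F st x = {y \<in> objects F. st y = st x \<and> obj_size F y = obj_size F x}"

text \<open>
  The terms, with multiplicity, of the product of two classes: the common value of the multisets
  of classes obtained from all pairs of representatives.
\<close>

definition class_shuffle ::
    "'a shuffle_family \<Rightarrow> ('a \<Rightarrow> 's) \<Rightarrow> 'a set \<Rightarrow> 'a set \<Rightarrow> 'a set multiset" where
  "class_shuffle F st C D =
     (THE M. \<forall>x\<in>C. \<forall>y\<in>D. M = image_mset (st_class F st) (obj_shuffle F x y))"

text \<open>
  Formal rational linear combinations of classes, with the bilinear extension of the product of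
  classes; the basis vector of a class \<open>C\<close> is \<open>Poly_Mapping.single C 1\<close>.
\<close>

definition stat_algebra ::
    "'a shuffle_family \<Rightarrow> ('a \<Rightarrow> 's) \<Rightarrow> (rat, 'a set \<Rightarrow>\<^sub>0 rat) module" where
  "stat_algebra F st =
     \<lparr>carrier = {u. Poly_Mapping.keys u \<subseteq> st_class F st ` objects F},
      monoid.mult = (\<lambda>u v. \<Sum>C\<in>Poly_Mapping.keys u. \<Sum>D\<in>Poly_Mapping.keys v.
        \<Sum>E\<in>#class_shuffle F st C D.
          Poly_Mapping.single E (Poly_Mapping.lookup u C * Poly_Mapping.lookup v D)),
      one = Poly_Mapping.single (st_class F st (empty_obj F)) 1,
      ring.zero = 0,
      add = (+),
      module.smult = (\<lambda>c. Poly_Mapping.map ((*) c))\<rparr>"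

definition basis_elem :: "'a shuffle_family \<Rightarrow> ('a \<Rightarrow> 's) \<Rightarrow> 'a \<Rightarrow> 'a set \<Rightarrow>\<^sub>0 rat" where
  "basis_elem F st x = Poly_Mapping.single (st_class F st x) 1"

text \<open>For a weakly shuffle-compatible statistic, products of classes are as expected.\<close>

lemma class_shuffle_st_class:
  assumes compat: "weakly_shuffle_compatible F st"
    and size: "\<And>x y z. x \<in> objects F \<Longrightarrow> y \<in> objects F \<Longrightarrow> z \<in># obj_shuffle F x y \<Longrightarrow>
                 obj_size F z = obj_size F x + obj_size F y"
    and x: "x \<in> objects F" and y: "y \<in> objects F"
  shows "class_shuffle F st (st_class F st x) (st_class F st y) =
         image_mset (st_class F st) (obj_shuffle F x y)"
proof -
  define cl where
    "cl = (\<lambda>s. {z \<in> objects F. st z = s \<and> obj_size F z = obj_size F x + obj_size F y})"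
  have *: "image_mset (st_class F st) (obj_shuffle F x' y') =
        image_mset cl (image_mset st (obj_shuffle F x' y'))"
    if "x' \<in> st_class F st x" "y' \<in> st_class F st y" for x' y'
  proof -
    have "st_class F st z = cl (st z)" if "z \<in># obj_shuffle F x' y'" for z
      using size[OF _ _ that] \<open>x' \<in> _\<close> \<open>y' \<in> _\<close> by (auto simp: st_class_def cl_def)
    then show ?thesis
      by (simp add: multiset.map_comp cong: image_mset_cong)
  qed
  have xy: "x \<in> st_class F st x" "y \<in> st_class F st y"
    using x y by (auto simp: st_class_def)
  have eq: "image_mset (st_class F st) (obj_shuffle F x' y') =
        image_mset (st_class F st) (obj_shuffle F x y)"
    if x': "x' \<in> st_class F st x" and y': "y' \<in> st_class F st y" for x' y'
  proof -
    have "image_mset st (obj_shuffle F x' y') = image_mset st (obj_shuffle F x y)"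
      using compat[unfolded weakly_shuffle_compatible_def, THEN bspec, THEN bspec, THEN bspec,
          THEN bspec, THEN mp, of x' x y' y] x y x' y'
      unfolding st_class_def by blast
    then show ?thesis
      by (simp only: *[OF x' y'] *[OF xy])
  qed
  show ?thesis
    unfolding class_shuffle_def
  proof (rule the_equality)
    show "\<forall>x'\<in>st_class F st x. \<forall>y'\<in>st_class F st y.
        image_mset (st_class F st) (obj_shuffle F x y) =
        image_mset (st_class F st) (obj_shuffle F x' y')"
      by (intro ballI) (rule eq[symmetric])
  next
    fix M
    assume "\<forall>x'\<in>st_class F st x. \<forall>y'\<in>st_class F st y.
        M = image_mset (st_class F st) (obj_shuffle F x' y')"
    then show "M = image_mset (st_class F st) (obj_shuffle F x y)"
      using xy by blast
  qed
qed

lemma basis_elem_mult: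
  assumes "weakly_shuffle_compatible F st"
    and "\<And>x y z. x \<in> objects F \<Longrightarrow> y \<in> objects F \<Longrightarrow> z \<in># obj_shuffle F x y \<Longrightarrow>
           obj_size F z = obj_size F x + obj_size F y"
    and "x \<in> objects F" and "y \<in> objects F"
  shows "basis_elem F st x \<otimes>\<^bsub>stat_algebra F st\<^esub> basis_elem F st y =
         (\<Sum>z\<in>#obj_shuffle F x y. basis_elem F st z)"
  using class_shuffle_st_class[OF assms]
  by (simp add: stat_algebra_def basis_elem_def multiset.map_comp o_def)


section \<open>Isomorphisms of algebras\<close>

text \<open>The library locale \<open>algebra\<close> requires commutativity.\<close>

definition assoc_algebra :: "'k ring \<Rightarrow> ('k, 'a) module \<Rightarrow> bool" where
  "assoc_algebra K A \<longleftrightarrow> module K A \<and> ring A \<and>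
     (\<forall>c\<in>carrier K. \<forall>u\<in>carrier A. \<forall>v\<in>carrier A.
        (c \<odot>\<^bsub>A\<^esub> u) \<otimes>\<^bsub>A\<^esub> v = c \<odot>\<^bsub>A\<^esub> (u \<otimes>\<^bsub>A\<^esub> v) \<and>
        u \<otimes>\<^bsub>A\<^esub> (c \<odot>\<^bsub>A\<^esub> v) = c \<odot>\<^bsub>A\<^esub> (u \<otimes>\<^bsub>A\<^esub> v))"

definition algebra_iso :: "'k ring \<Rightarrow> ('k, 'a) module \<Rightarrow> ('k, 'b) module \<Rightarrow> ('a \<Rightarrow> 'b) set" where
  "algebra_iso K A B = {h. assoc_algebra K A \<and> assoc_algebra K B \<and> h \<in> ring_iso A B \<and>
     (\<forall>c\<in>carrier K. \<forall>u\<in>carrier A. h (c \<odot>\<^bsub>A\<^esub> u) = c \<odot>\<^bsub>B\<^esub> h u)}"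


section \<open>Set partitions\<close>

definition set_partitions :: "nat set set set" where
  "set_partitions = (\<Union>n. {\<pi>. partition_on {1..n} \<pi>})"

definition sp_size :: "nat set set \<Rightarrow> nat" where
  "sp_size \<pi> = card (\<Union>\<pi>)"

text \<open>
  The list indexing starts at 0, and the number of smaller elements of the ground set of \<open>\<pi>\<close> is
  the 0-based position of \<open>i\<close> in it.
\<close>

definition shift :: "nat set \<Rightarrow> nat set set \<Rightarrow> nat set set" where
  "shift S \<pi> = (\<lambda>B. (\<lambda>i. sorted_list_of_set S ! card {j \<in> \<Union>\<pi>. j < i}) ` B) ` \<pi>"

definition arc_shuffle :: "nat set set \<Rightarrow> nat set set \<Rightarrow> nat set set multiset" where
  "arc_shuffle \<tau> \<theta> =
     (let n = sp_size \<tau>; m = sp_size \<theta> in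
      image_mset (\<lambda>S. shift S \<tau> \<union> shift ({1..n + m} - S) \<theta>)
        (mset_set {S. S \<subseteq> {1..n + m} \<and> card S = n}))"

definition SP :: "nat set set shuffle_family" where
  "SP = \<lparr>objects = set_partitions, obj_size = sp_size, obj_shuffle = arc_shuffle, empty_obj = {}\<rparr>"

definition bk1 :: "nat set set \<Rightarrow> nat" where
  "bk1 \<pi> = (if \<pi> = {} then 0 else card (THE B. B \<in> \<pi> \<and> 1 \<in> B))"


section \<open>Parking functions\<close>

definition parking_functions :: "nat list set" where
  "parking_functions =
     {\<alpha>. (\<forall>a\<in>set \<alpha>. 1 \<le> a) \<and> (\<forall>i<length \<alpha>. sort \<alpha> ! i \<le> Suc i)}"

text \<open>
  The interleavings form a set; as a multiset each has multiplicity one.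
\<close>

definition shifted_shuffle :: "nat list \<Rightarrow> nat list \<Rightarrow> nat list multiset" where
  "shifted_shuffle \<alpha> \<beta> = mset_set (shuffles \<alpha> (map (\<lambda>b. b + length \<alpha>) \<beta>))"

definition PF :: "nat list shuffle_family" where
  "PF = \<lparr>objects = parking_functions, obj_size = length, obj_shuffle = shifted_shuffle,
         empty_obj = []\<rparr>"

definition lel :: "nat list \<Rightarrow> nat" where
  "lel \<alpha> = card {i. i < length \<alpha> \<and> \<alpha> ! i = \<alpha> ! 0}"


section \<open>From set partitions to parking functions\<close>

definition sp_to_pf :: "nat set set \<Rightarrow> nat list" where
  "sp_to_pf \<pi> = replicate (bk1 \<pi>) 1 @ replicate (sp_size \<pi> - bk1 \<pi>) 2"

end

theory Submission
  imports Defs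
begin

text \<open>
  A term of the product of two nonempty objects inherits its value from the factor that contributes
  the element \<open>1\<close> (for set partitions) or the first entry (for parking functions, where the shift
  makes the entries of the factors disjoint).
  Hence in both algebras, writing \<open>[k, n]\<close> for the class of the objects of size
  \<open>n\<close> with value \<open>k\<close>,
  \<open>[k, n] [l, m] = (n + m - 1 choose m) [k, n + m] + (n + m - 1 choose n) [l, n + m]\<close>
  for \<open>n, m > 0\<close>, and the class of the empty object is a unit. Associativity reduces to identities
  between binomial coefficients. The classes correspond because both statistics take exactly the
  values \<open>1, \<dots>, n\<close> on objects of size \<open>n > 0\<close>.
\<close>

section \<open>Linear extension\<close>

text \<open>Nesting two of these gives the bilinear extension of a product of classes, which reduces
  the ring axioms to identities on basis vectors.\<close>

definition linear_ext ::
    "('a \<Rightarrow> 'b \<Rightarrow>\<^sub>0 'c::comm_ring_1) \<Rightarrow> ('a \<Rightarrow>\<^sub>0 'c) \<Rightarrow> 'b \<Rightarrow>\<^sub>0 'c" where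
  "linear_ext h u = (\<Sum>a\<in>Poly_Mapping.keys u. Poly_Mapping.map ((*) (Poly_Mapping.lookup u a)) (h a))"

lemma lookup_map_times [simp]:
  fixes c :: "'c::comm_ring_1"
  shows "Poly_Mapping.lookup (Poly_Mapping.map ((*) c) u) a = c * Poly_Mapping.lookup u a"
  by (simp add: Poly_Mapping.map.rep_eq when_def)

lemma keys_map_times: "Poly_Mapping.keys (Poly_Mapping.map ((*) (c::'c::comm_ring_1)) u) \<subseteq> Poly_Mapping.keys u"
  by (auto simp: in_keys_iff)

text \<open>Indices outside the support contribute zero. The freedom in \<open>A\<close> lets
  mappings with different supports be compared over one common index set.\<close>

lemma lookup_linear_ext:
  assumes "finite A" "Poly_Mapping.keys u \<subseteq> A"
  shows "Poly_Mapping.lookup (linear_ext h u) b =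
         (\<Sum>a\<in>A. Poly_Mapping.lookup u a * Poly_Mapping.lookup (h a) b)"
  unfolding linear_ext_def lookup_sum
  using assms by (auto intro!: sum.mono_neutral_cong_left simp: in_keys_iff)

lemma keys_linear_ext_subset:
  assumes "\<And>a. a \<in> Poly_Mapping.keys u \<Longrightarrow> Poly_Mapping.keys (h a) \<subseteq> B"
  shows "Poly_Mapping.keys (linear_ext h u) \<subseteq> B"
  unfolding linear_ext_def
  by (rule order.trans[OF keys_sum]) (use keys_map_times assms in fast)

lemma linear_ext_cong:
  "(\<And>a. a \<in> Poly_Mapping.keys u \<Longrightarrow> h a = h' a) \<Longrightarrow> linear_ext h u = linear_ext h' u"
  by (simp add: linear_ext_def)

lemma linear_ext_single [simp]:
  "linear_ext h (Poly_Mapping.single a c) = Poly_Mapping.map ((*) c) (h a)"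
  by (rule poly_mapping_eqI)
    (simp add: lookup_linear_ext[of "{a}"])

lemma linear_ext_add: "linear_ext h (u + v) = linear_ext h u + linear_ext h v"
proof (rule poly_mapping_eqI)
  fix b
  have "Poly_Mapping.keys (u + v) \<subseteq> Poly_Mapping.keys u \<union> Poly_Mapping.keys v"
    by (rule keys_add)
  then show "Poly_Mapping.lookup (linear_ext h (u + v)) b =
      Poly_Mapping.lookup (linear_ext h u + linear_ext h v) b"
    by (simp add: lookup_linear_ext[of "Poly_Mapping.keys u \<union> Poly_Mapping.keys v"] lookup_add
        ring_distribs sum.distrib)
qed

lemma linear_ext_zero [simp]: "linear_ext h 0 = 0"
  by (simp add: linear_ext_def)

lemma linear_ext_sum: "linear_ext h (\<Sum>i\<in>I. f i) = (\<Sum>i\<in>I. linear_ext h (f i))"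
  by (induction I rule: infinite_finite_induct) (simp_all add: linear_ext_add)

lemma linear_ext_sum_mset: "linear_ext h (\<Sum>i\<in>#M. f i) = (\<Sum>i\<in>#M. linear_ext h (f i))"
  by (induction M) (simp_all add: linear_ext_add)

lemma linear_ext_smult:
  "linear_ext h (Poly_Mapping.map ((*) c) u) = Poly_Mapping.map ((*) c) (linear_ext h u)"
  by (rule poly_mapping_eqI)
    (simp add: lookup_linear_ext[of "Poly_Mapping.keys u"] keys_map_times sum_distrib_left mult.assoc)

lemma map_times_zero [simp]: "Poly_Mapping.map ((*) (c::'c::comm_ring_1)) 0 = 0"
  by (rule poly_mapping_eqI) simp

lemma map_times_one [simp]: "Poly_Mapping.map ((*) (1::'c::comm_ring_1)) u = u"
  by (rule poly_mapping_eqI) simp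

lemma linear_ext_fun_add: "linear_ext (\<lambda>a. h a + h' a) u = linear_ext h u + linear_ext h' u"
  by (rule poly_mapping_eqI)
    (simp add: lookup_linear_ext[of "Poly_Mapping.keys u"] lookup_add ring_distribs sum.distrib)

lemma linear_ext_fun_smult:
  "linear_ext (\<lambda>a. Poly_Mapping.map ((*) c) (h a)) u = Poly_Mapping.map ((*) c) (linear_ext h u)"
  by (rule poly_mapping_eqI)
    (simp add: lookup_linear_ext[of "Poly_Mapping.keys u"] sum_distrib_left mult.left_commute)

lemma linear_ext_linear_ext: "linear_ext k (linear_ext h u) = linear_ext (\<lambda>a. linear_ext k (h a)) u"
  unfolding linear_ext_def[of h u] linear_ext_def[of _ u]
  by (simp add: linear_ext_sum linear_ext_smult)

text \<open>An exchange of two finite sums. Together with \<open>linear_ext_linear_ext\<close> it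
  brings both bracketings of a triple product to the same nested form.\<close>

lemma linear_ext_swap:
  "linear_ext (\<lambda>a. linear_ext (h a) v) u = linear_ext (\<lambda>b. linear_ext (\<lambda>a. h a b) u) v"
proof (rule poly_mapping_eqI)
  fix c
  show "Poly_Mapping.lookup (linear_ext (\<lambda>a. linear_ext (h a) v) u) c =
      Poly_Mapping.lookup (linear_ext (\<lambda>b. linear_ext (\<lambda>a. h a b) u) v) c"
    unfolding lookup_linear_ext[OF finite_keys order_refl]
    by (simp add: sum_distrib_left mult.left_commute sum.swap[of _ "Poly_Mapping.keys u"])
qed

lemma linear_ext_single_id [simp]: "linear_ext (\<lambda>a. Poly_Mapping.single a 1) u = u"
  by (rule poly_mapping_eqI)
    (simp add: lookup_linear_ext[of "Poly_Mapping.keys u"] lookup_single when_def in_keys_iff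
      if_distrib[of "(*) _"] cong: if_cong)


section \<open>Auxiliary facts on multisets\<close>

lemma image_mset_set_const:
  assumes "\<And>x. x \<in> A \<Longrightarrow> f x = c"
  shows "image_mset f (mset_set A) = replicate_mset (card A) c"
proof (cases "finite A")
  case True
  then have "image_mset f (mset_set A) = image_mset (\<lambda>_. c) (mset_set A)"
    using assms by (intro image_mset_cong) simp
  then show ?thesis by (simp add: image_mset_const_eq)
qed simp

lemma sum_mset_single:
  fixes c :: "'c::comm_ring_1"
  shows "(\<Sum>E\<in>#M. Poly_Mapping.single E c) =
         Poly_Mapping.map ((*) c) (\<Sum>E\<in>#M. Poly_Mapping.single E 1)"
proof (induction M)
  case (add E M)
  then show ?case
    by (intro poly_mapping_eqI) (simp add: lookup_add lookup_single when_def ring_distribs)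
qed simp

section \<open>Statistics determined by the first letter\<close>

definition class_prod ::
    "'a shuffle_family \<Rightarrow> ('a \<Rightarrow> 's) \<Rightarrow> 'a set \<Rightarrow> 'a set \<Rightarrow> 'a set \<Rightarrow>\<^sub>0 rat" where
  "class_prod F st C D = (\<Sum>E\<in>#class_shuffle F st C D. Poly_Mapping.single E 1)"

text \<open>In \<open>stat_algebra\<close> the coefficients sit inside the terms of each class
  product; pulling them out with \<open>sum_mset_single\<close> exhibits the bilinearity.\<close>

lemma stat_algebra_mult:
  "u \<otimes>\<^bsub>stat_algebra F st\<^esub> v = linear_ext (\<lambda>C. linear_ext (class_prod F st C) v) u"
proof -
  have "u \<otimes>\<^bsub>stat_algebra F st\<^esub> v = (\<Sum>C\<in>Poly_Mapping.keys u. \<Sum>D\<in>Poly_Mapping.keys v.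
      Poly_Mapping.map ((*) (Poly_Mapping.lookup u C * Poly_Mapping.lookup v D))
        (class_prod F st C D))"
    by (simp add: stat_algebra_def class_prod_def flip: sum_mset_single)
  also have "\<dots> = linear_ext (\<lambda>C. linear_ext (class_prod F st C) v) u"
    unfolding linear_ext_def
    by (rule poly_mapping_eqI) (simp add: lookup_sum sum_distrib_left mult.assoc)
  finally show ?thesis .
qed

lemma stat_algebra_simps:
  "carrier (stat_algebra F st) = {u. Poly_Mapping.keys u \<subseteq> st_class F st ` objects F}"
  "\<one>\<^bsub>stat_algebra F st\<^esub> = Poly_Mapping.single (st_class F st (empty_obj F)) 1"
  "\<zero>\<^bsub>stat_algebra F st\<^esub> = 0"
  "u \<oplus>\<^bsub>stat_algebra F st\<^esub> v = u + v"
  "c \<odot>\<^bsub>stat_algebra F st\<^esub> u = Poly_Mapping.map ((*) c) u"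
  by (simp_all add: stat_algebra_def)

lemma st_class_eq_iff:
  "x \<in> objects F \<Longrightarrow>
   st_class F st x = st_class F st y \<longleftrightarrow> st x = st y \<and> obj_size F x = obj_size F y"
  unfolding st_class_def by auto

text \<open>Additively this is the free rational vector space on the classes, so the axioms hold
  coefficientwise.\<close>

lemma module_stat_algebra:
  "module (ring_of_type_algebra :: rat ring) (stat_algebra F st)"
proof (rule moduleI)
  show "abelian_group (stat_algebra F st)"
  proof (rule abelian_groupI)
    fix u assume "u \<in> carrier (stat_algebra F st)"
    then show "\<exists>v\<in>carrier (stat_algebra F st). v \<oplus>\<^bsub>stat_algebra F st\<^esub> u = \<zero>\<^bsub>stat_algebra F st\<^esub>"
      by (intro bexI[of _ "- u"]) (simp_all add: stat_algebra_simps)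
  next
    fix u v assume "u \<in> carrier (stat_algebra F st)" "v \<in> carrier (stat_algebra F st)"
    then show "u \<oplus>\<^bsub>stat_algebra F st\<^esub> v \<in> carrier (stat_algebra F st)"
      using keys_add[of u v] by (auto simp: stat_algebra_simps)
  qed (simp_all add: stat_algebra_simps ac_simps)
next
  fix c and u assume "u \<in> carrier (stat_algebra F st)"
  then show "c \<odot>\<^bsub>stat_algebra F st\<^esub> u \<in> carrier (stat_algebra F st)"
    using keys_map_times[of c u] by (auto simp: stat_algebra_simps)
\<comment> \<open>The \<open>cring\<close> goal has to be closed before
  \<open>ring_of_type_algebra\<close> is unfolded in the other goals.\<close>
qed (simp_all add: cring_from_type_algebra, simp_all add: stat_algebra_simps ring_of_type_algebra_def,
    auto intro!: poly_mapping_eqI simp: lookup_add ring_distribs mult.assoc)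

text \<open>
  Of the \<open>n + m choose n\<close> shuffles of objects of sizes \<open>n\<close> and \<open>m\<close>, not both \<open>0\<close>, exactly
  \<open>n + m - 1 choose m\<close> start with a letter of the first object. The case \<open>n = m = 0\<close> is separate
  because truncated subtraction would count the only shuffle twice.
\<close>

locale first_letter_statistic =
  fixes F :: "'a shuffle_family" and st :: "'a \<Rightarrow> 's"
  assumes empty_obj: "empty_obj F \<in> objects F"
    and size_empty_obj: "obj_size F (empty_obj F) = 0"
    and st_size_zero: "x \<in> objects F \<Longrightarrow> obj_size F x = 0 \<Longrightarrow> st x = st (empty_obj F)"
    and shuffle_objects:
      "x \<in> objects F \<Longrightarrow> y \<in> objects F \<Longrightarrow> z \<in># obj_shuffle F x y \<Longrightarrow> z \<in> objects F"
    and shuffle_size: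
      "x \<in> objects F \<Longrightarrow> y \<in> objects F \<Longrightarrow> z \<in># obj_shuffle F x y \<Longrightarrow>
       obj_size F z = obj_size F x + obj_size F y"
    and st_shuffle_zero:
      "x \<in> objects F \<Longrightarrow> y \<in> objects F \<Longrightarrow> obj_size F x + obj_size F y = 0 \<Longrightarrow>
       image_mset st (obj_shuffle F x y) = {#st x#}"
    and st_shuffle:
      "x \<in> objects F \<Longrightarrow> y \<in> objects F \<Longrightarrow> obj_size F x + obj_size F y > 0 \<Longrightarrow>
       image_mset st (obj_shuffle F x y) =
         replicate_mset (obj_size F x + obj_size F y - 1 choose obj_size F y) (st x) +
         replicate_mset (obj_size F x + obj_size F y - 1 choose obj_size F x) (st y)"
begin

text \<open>The right-hand sides of \<open>st_shuffle_zero\<close> and \<open>st_shuffle\<close>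
  mention the objects only through their values and sizes.\<close>

lemma compatible: "weakly_shuffle_compatible F st"
  unfolding weakly_shuffle_compatible_def
proof (intro ballI impI)
  fix x x' y y'
  assume *: "x \<in> objects F" "x' \<in> objects F" "y \<in> objects F" "y' \<in> objects F"
    and eq: "st x = st x' \<and> st y = st y' \<and> obj_size F x = obj_size F x' \<and> obj_size F y = obj_size F y'"
  show "image_mset st (obj_shuffle F x y) = image_mset st (obj_shuffle F x' y')"
  proof (cases "obj_size F x + obj_size F y = 0")
    case True
    then show ?thesis using * eq by (simp add: st_shuffle_zero)
  next
    case False
    then show ?thesis using * eq by (simp add: st_shuffle)
  qed
qed

text \<open>Unlike \<open>st_class\<close> this names a class without a representative; the set may
  be empty.\<close>

abbreviation cls :: "'s \<Rightarrow> nat \<Rightarrow> 'a set" where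
  "cls s n \<equiv> {z \<in> objects F. st z = s \<and> obj_size F z = n}"

lemma class_prod_eq:
  assumes "x \<in> objects F" "y \<in> objects F"
  shows "class_prod F st (st_class F st x) (st_class F st y) =
         (\<Sum>z\<in>#obj_shuffle F x y. Poly_Mapping.single (st_class F st z) 1)"
  unfolding class_prod_def
  by (subst class_shuffle_st_class[OF compatible shuffle_size assms])
    (simp_all add: multiset.map_comp o_def)

text \<open>All shuffles have the same size, so the class of a shuffle is determined by its value,
  and the product depends only on the multiset of values.\<close>

lemma class_prod_values:
  assumes "x \<in> objects F" "y \<in> objects F"
  shows "class_prod F st (st_class F st x) (st_class F st y) =
         (\<Sum>s\<in>#image_mset st (obj_shuffle F x y).
            Poly_Mapping.single (cls s (obj_size F x + obj_size F y)) 1)"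
  unfolding class_prod_eq[OF assms] multiset.map_comp o_def
  by (intro arg_cong[of _ _ sum_mset] image_mset_cong) (simp add: st_class_def shuffle_size[OF assms])

text \<open>When exactly one factor has size 0, the binomial coefficient of its own term vanishes,
  so it does no harm that the \<open>cls\<close> in that term may be empty.\<close>

lemma class_prod_pos:
  assumes "x \<in> objects F" "y \<in> objects F" "obj_size F x + obj_size F y > 0"
  shows "class_prod F st (st_class F st x) (st_class F st y) =
    Poly_Mapping.single (cls (st x) (obj_size F x + obj_size F y))
      (of_nat (obj_size F x + obj_size F y - 1 choose obj_size F y)) +
    Poly_Mapping.single (cls (st y) (obj_size F x + obj_size F y))
      (of_nat (obj_size F x + obj_size F y - 1 choose obj_size F x))"
proof -
  have "\<Sum>\<^sub># (replicate_mset k (Poly_Mapping.single (cls t n) (1::rat))) =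
      Poly_Mapping.single (cls t n) (of_nat k)" for k t n
    by (induction k) (simp_all add: single_add)
  then show ?thesis
    unfolding class_prod_values[OF assms(1,2)] st_shuffle[OF assms] by simp
qed

lemma st_class_size_zero:
  "x \<in> objects F \<Longrightarrow> obj_size F x = 0 \<Longrightarrow> st_class F st x = st_class F st (empty_obj F)"
  using st_size_zero by (simp add: st_class_eq_iff size_empty_obj)

lemma class_prod_unit_left:
  assumes "x \<in> objects F" "y \<in> objects F" "obj_size F x = 0"
  shows "class_prod F st (st_class F st x) (st_class F st y) = Poly_Mapping.single (st_class F st y) 1"
proof (cases "obj_size F y = 0")
  case True
  then have "st y = st x" using assms st_size_zero by metis
  with True show ?thesis using assms
    by (simp add: class_prod_values st_shuffle_zero) (simp add: st_class_def)
next
  case False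
  then show ?thesis using assms by (simp add: class_prod_pos binomial_eq_0) (simp add: st_class_def)
qed

lemma class_prod_unit_right:
  assumes "x \<in> objects F" "y \<in> objects F" "obj_size F y = 0"
  shows "class_prod F st (st_class F st x) (st_class F st y) = Poly_Mapping.single (st_class F st x) 1"
proof (cases "obj_size F x = 0")
  case True
  with assms show ?thesis
    by (simp add: class_prod_values st_shuffle_zero) (simp add: st_class_def)
next
  case False
  then show ?thesis using assms by (simp add: class_prod_pos binomial_eq_0) (simp add: st_class_def)
qed

lemma keys_class_prod:
  assumes "x \<in> objects F" "y \<in> objects F"
  shows "Poly_Mapping.keys (class_prod F st (st_class F st x) (st_class F st y)) \<subseteq> st_class F st ` objects F"
proof -
  have "Poly_Mapping.keys (\<Sum>z\<in>#M. Poly_Mapping.single (st_class F st z) (1::rat)) \<subseteq> st_class F st ` objects F"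
    if "set_mset M \<subseteq> objects F" for M
    using that
  proof (induction M)
    case (add z M)
    then show ?case
      by (simp, intro order.trans[OF keys_add]) simp
  qed simp
  then show ?thesis
    using shuffle_objects[OF assms] by (auto simp: class_prod_eq[OF assms])
qed

text \<open>With both sizes positive, both binomial coefficients in \<open>st_shuffle\<close> are
  positive, so each value occurs among the shuffles. This supplies representatives for the classes
  in a product, which is then ready to be multiplied again.\<close>

lemma ex_first_letter:
  assumes "x \<in> objects F" "y \<in> objects F" "obj_size F x > 0" "obj_size F y > 0"
  shows "\<exists>z\<in>objects F. st z = st x \<and> obj_size F z = obj_size F x + obj_size F y"
    and "\<exists>z\<in>objects F. st z = st y \<and> obj_size F z = obj_size F x + obj_size F y"
proof -
  have *: "\<exists>z\<in>objects F. st z = s \<and> obj_size F z = obj_size F x + obj_size F y"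
    if s: "s \<in># image_mset st (obj_shuffle F x y)" for s
  proof -
    obtain z where "z \<in># obj_shuffle F x y" "st z = s" using s by auto
    then show ?thesis
      using shuffle_objects[OF assms(1,2)] shuffle_size[OF assms(1,2)] by blast
  qed
  show "\<exists>z\<in>objects F. st z = st x \<and> obj_size F z = obj_size F x + obj_size F y"
    "\<exists>z\<in>objects F. st z = st y \<and> obj_size F z = obj_size F x + obj_size F y"
    using assms by (intro *; simp add: st_shuffle; arith)+
qed

end

section \<open>Binomial identities for associativity\<close>

text \<open>Pascal's rule after a reflection of the first coefficient; it counts all shuffles by the
  origin of their first letter.\<close>

lemma choose_pred_add:
  assumes "i + j > (0::nat)"
  shows "(i + j - 1 choose j) + (i + j - 1 choose i) = (i + j choose i)"
proof (cases i)
  case 0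
  then show ?thesis using assms by simp
next
  case (Suc k)
  have "(k + j choose j) = (k + j choose k)"
    using binomial_symmetric[of k "k + j"] by simp
  with Suc show ?thesis by simp
qed

text \<open>For factors of sizes \<open>n\<close>, \<open>m\<close>, \<open>p\<close>, the three
  identities compare the coefficients of the terms that start with a letter of the first, second and
  third factor. All follow from \<open>choose_mult\<close>, the count of a subset inside a
  subset.\<close>

lemma choose_assoc:
  fixes n m p :: nat
  assumes "n > 0" "m > 0" "p > 0"
  shows "(n + m - 1 choose m) * (n + m + p - 1 choose p) =
         (m + p - 1 choose p) * (n + m + p - 1 choose (m + p)) +
         (m + p - 1 choose m) * (n + m + p - 1 choose (m + p))" (is ?first)
    and "(n + m - 1 choose n) * (n + m + p - 1 choose p) =
         (m + p - 1 choose p) * (n + m + p - 1 choose n)" (is ?second)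
    and "(n + m - 1 choose m) * (n + m + p - 1 choose (n + m)) +
         (n + m - 1 choose n) * (n + m + p - 1 choose (n + m)) =
         (m + p - 1 choose m) * (n + m + p - 1 choose n)" (is ?third)
proof -
  have "(n + m + p - 1 choose (m + p)) * (m + p choose p) =
      (n + m + p - 1 choose p) * (n + m - 1 choose m)"
    using assms choose_mult[of p "m + p" "n + m + p - 1"] by (simp add: diff_diff_add)
  moreover have "(m + p - 1 choose p) + (m + p - 1 choose m) = (m + p choose p)"
    using choose_pred_add[of p m] assms by (simp add: add.commute)
  ultimately show ?first
    unfolding distrib_right[symmetric] by (simp add: mult.commute)
  \<comment> \<open>Behind a first letter of the second factor, the positions of the other two
    factors can be chosen in either order. Both counts equal the choice of their union followed by a
    split of it.\<close>
  have "(n + m + p - 1 choose (n + p)) * (n + p choose p) =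
      (n + m + p - 1 choose p) * (n + m - 1 choose n)"
    using assms choose_mult[of p "n + p" "n + m + p - 1"] by (simp add: diff_diff_add)
  moreover have "(n + m + p - 1 choose (n + p)) * (n + p choose n) =
      (n + m + p - 1 choose n) * (m + p - 1 choose p)"
    using assms choose_mult[of n "n + p" "n + m + p - 1"] by (simp add: add.assoc)
  moreover have "(n + p choose n) = (n + p choose p)"
    using binomial_symmetric[of n "n + p"] by simp
  ultimately show ?second by (simp add: mult.commute)
  have "(n + m + p - 1 choose (n + m)) * (n + m choose n) =
      (n + m + p - 1 choose n) * (m + p - 1 choose m)"
    using assms choose_mult[of n "n + m" "n + m + p - 1"] by (simp add: add.assoc)
  then show ?third
    unfolding distrib_right[symmetric] using choose_pred_add[of n m] assms by (simp add: mult.commute)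
qed

section \<open>Associativity and the algebra structure\<close>

context first_letter_statistic
begin

text \<open>If a factor has size 0, its class is a unit. Otherwise both sides are combinations of
  the classes with values \<open>st x\<close>, \<open>st y\<close>, \<open>st z\<close> at the total
  size, and the coefficients agree term by term, even when some of the values coincide.\<close>

lemma class_prod_assoc:
  assumes x: "x \<in> objects F" and y: "y \<in> objects F" and z: "z \<in> objects F"
  shows "linear_ext (\<lambda>E. class_prod F st E (st_class F st z)) (class_prod F st (st_class F st x) (st_class F st y)) =
         linear_ext (class_prod F st (st_class F st x)) (class_prod F st (st_class F st y) (st_class F st z))"
    (is "?lhs = ?rhs")
proof -
  consider "obj_size F x = 0" | "obj_size F y = 0" | "obj_size F z = 0"
    | "obj_size F x > 0" "obj_size F y > 0" "obj_size F z > 0"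
    by auto
  then show ?thesis
  proof cases
    case 1
    \<comment> \<open>By \<open>keys_class_prod\<close> the support consists of genuine classes, on
      which the class of \<open>x\<close> acts as the identity.\<close>
    have "?rhs = linear_ext (\<lambda>E. Poly_Mapping.single E 1) (class_prod F st (st_class F st y) (st_class F st z))"
      using keys_class_prod[OF y z] 1 x by (intro linear_ext_cong) (auto simp: class_prod_unit_left)
    then show ?thesis
      using 1 assms by (simp add: class_prod_unit_left)
  next
    case 2
    then show ?thesis
      using assms by (simp add: class_prod_unit_left class_prod_unit_right)
  next
    case 3
    have "?lhs = linear_ext (\<lambda>E. Poly_Mapping.single E 1) (class_prod F st (st_class F st x) (st_class F st y))"
      using keys_class_prod[OF x y] 3 z by (intro linear_ext_cong) (auto simp: class_prod_unit_right)
    then show ?thesis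
      using 3 assms by (simp add: class_prod_unit_right)
  next
    case 4
    define n m p where "n = obj_size F x" and "m = obj_size F y" and "p = obj_size F z"
    note pos = 4[folded n_def m_def p_def]
    \<comment> \<open>Representatives are needed because \<open>class_prod_pos\<close> multiplies
      classes of given objects.\<close>
    obtain xy where xy: "xy \<in> objects F" "st xy = st x" "obj_size F xy = n + m"
      using ex_first_letter(1)[OF x y 4(1,2)] by (auto simp: n_def m_def)
    obtain yx where yx: "yx \<in> objects F" "st yx = st y" "obj_size F yx = n + m"
      using ex_first_letter(2)[OF x y 4(1,2)] by (auto simp: n_def m_def)
    obtain yz where yz: "yz \<in> objects F" "st yz = st y" "obj_size F yz = m + p"
      using ex_first_letter(1)[OF y z 4(2,3)] by (auto simp: p_def m_def)
    obtain zy where zy: "zy \<in> objects F" "st zy = st z" "obj_size F zy = m + p"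
      using ex_first_letter(2)[OF y z 4(2,3)] by (auto simp: p_def m_def)
    have cls: "cls (st x) (n + m) = st_class F st xy" "cls (st y) (n + m) = st_class F st yx"
      "cls (st y) (m + p) = st_class F st yz" "cls (st z) (m + p) = st_class F st zy"
      using xy yx yz zy by (simp_all add: st_class_def)
    \<comment> \<open>Coefficients are kept as natural numbers under \<open>of_nat\<close>, so that
      \<open>choose_assoc\<close> can rewrite them directly.\<close>
    let ?S = "\<lambda>s k. Poly_Mapping.single (cls s (n + m + p)) (of_nat k) :: _ \<Rightarrow>\<^sub>0 rat"
    note prod_xy = class_prod_pos[OF x y, folded n_def m_def]
    note prod_yz = class_prod_pos[OF y z, folded m_def p_def]
    have prods: "class_prod F st (cls (st x) (n + m)) (st_class F st z) =
        ?S (st x) (n + m + p - 1 choose p) + ?S (st z) (n + m + p - 1 choose (n + m))"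
      "class_prod F st (cls (st y) (n + m)) (st_class F st z) =
        ?S (st y) (n + m + p - 1 choose p) + ?S (st z) (n + m + p - 1 choose (n + m))"
      "class_prod F st (st_class F st x) (cls (st y) (m + p)) =
        ?S (st x) (n + m + p - 1 choose (m + p)) + ?S (st y) (n + m + p - 1 choose n)"
      "class_prod F st (st_class F st x) (cls (st z) (m + p)) =
        ?S (st x) (n + m + p - 1 choose (m + p)) + ?S (st z) (n + m + p - 1 choose n)"
      using pos class_prod_pos[OF xy(1) z, unfolded xy(2,3), folded p_def]
        class_prod_pos[OF yx(1) z, unfolded yx(2,3), folded p_def]
        class_prod_pos[OF x yz(1), unfolded yz(2,3), folded n_def]
        class_prod_pos[OF x zy(1), unfolded zy(2,3), folded n_def]
      unfolding cls by (simp_all add: add.assoc)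
    have "?lhs =
        ?S (st x) ((n + m - 1 choose m) * (n + m + p - 1 choose p)) +
        ?S (st y) ((n + m - 1 choose n) * (n + m + p - 1 choose p)) +
        ?S (st z) ((n + m - 1 choose m) * (n + m + p - 1 choose (n + m)) +
                   (n + m - 1 choose n) * (n + m + p - 1 choose (n + m)))"
      unfolding prod_xy[OF add_pos_pos[OF pos(1,2)]] linear_ext_add linear_ext_single prods
      by (rule poly_mapping_eqI) (simp add: lookup_add lookup_single when_def ring_distribs)
    also have "\<dots> = 
        ?S (st x) ((m + p - 1 choose p) * (n + m + p - 1 choose (m + p)) +
                   (m + p - 1 choose m) * (n + m + p - 1 choose (m + p))) +
        ?S (st y) ((m + p - 1 choose p) * (n + m + p - 1 choose n)) +
        ?S (st z) ((m + p - 1 choose m) * (n + m + p - 1 choose n))"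
      unfolding choose_assoc[OF pos] ..
    also have "\<dots> = ?rhs"
      unfolding prod_yz[OF add_pos_pos[OF pos(2,3)]] linear_ext_add linear_ext_single prods
      by (rule poly_mapping_eqI) (simp add: lookup_add lookup_single when_def ring_distribs)
    finally show ?thesis .
  qed
qed

lemma assoc_algebra: "assoc_algebra (ring_of_type_algebra :: rat ring) (stat_algebra F st)"
proof -
  let ?A = "stat_algebra F st" and ?P = "class_prod F st"
  interpret module "ring_of_type_algebra :: rat ring" ?A
    by (rule module_stat_algebra)
  have carrierD: "\<exists>x\<in>objects F. C = st_class F st x"
    if "u \<in> carrier ?A" "C \<in> Poly_Mapping.keys u" for u C
    using that by (auto simp: stat_algebra_simps)
  have smult_left: "(c \<odot>\<^bsub>?A\<^esub> u) \<otimes>\<^bsub>?A\<^esub> v = c \<odot>\<^bsub>?A\<^esub> (u \<otimes>\<^bsub>?A\<^esub> v)"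
    and smult_right: "u \<otimes>\<^bsub>?A\<^esub> (c \<odot>\<^bsub>?A\<^esub> v) = c \<odot>\<^bsub>?A\<^esub> (u \<otimes>\<^bsub>?A\<^esub> v)" for c u v
    by (simp_all add: stat_algebra_mult stat_algebra_simps linear_ext_smult linear_ext_fun_smult)
  have "ring ?A"
  proof (rule ringI)
    show "monoid ?A"
    proof (rule monoidI)
      fix u v assume uv: "u \<in> carrier ?A" "v \<in> carrier ?A"
      have "Poly_Mapping.keys (?P C D) \<subseteq> st_class F st ` objects F"
        if "C \<in> Poly_Mapping.keys u" "D \<in> Poly_Mapping.keys v" for C D
        using carrierD[OF uv(1) that(1)] carrierD[OF uv(2) that(2)] keys_class_prod by blast
      then show "u \<otimes>\<^bsub>?A\<^esub> v \<in> carrier ?A"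
        unfolding stat_algebra_mult stat_algebra_simps mem_Collect_eq
        by (intro keys_linear_ext_subset)
    next
      show "\<one>\<^bsub>?A\<^esub> \<in> carrier ?A"
        using empty_obj by (simp add: stat_algebra_simps)
    next
      fix u assume u: "u \<in> carrier ?A"
      have "linear_ext (?P (st_class F st (empty_obj F))) u = linear_ext (\<lambda>C. Poly_Mapping.single C 1) u"
        using carrierD[OF u] class_prod_unit_left[OF empty_obj _ size_empty_obj] by (intro linear_ext_cong) metis
      then show "\<one>\<^bsub>?A\<^esub> \<otimes>\<^bsub>?A\<^esub> u = u"
        unfolding stat_algebra_mult by (simp add: stat_algebra_simps)
      have "linear_ext (\<lambda>C. ?P C (st_class F st (empty_obj F))) u = linear_ext (\<lambda>C. Poly_Mapping.single C 1) u"
        using carrierD[OF u] class_prod_unit_right[OF _ empty_obj size_empty_obj] by (intro linear_ext_cong) metis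
      then show "u \<otimes>\<^bsub>?A\<^esub> \<one>\<^bsub>?A\<^esub> = u"
        unfolding stat_algebra_mult by (simp add: stat_algebra_simps)
    next
      fix u v w assume uvw: "u \<in> carrier ?A" "v \<in> carrier ?A" "w \<in> carrier ?A"
      have "(u \<otimes>\<^bsub>?A\<^esub> v) \<otimes>\<^bsub>?A\<^esub> w =
          linear_ext (\<lambda>C. linear_ext (\<lambda>D. linear_ext (\<lambda>G. linear_ext (\<lambda>E. ?P E G) (?P C D)) w) v) u"
        \<comment> \<open>The exchange meant is that of the innermost two extensions, over
          \<open>w\<close> and over the terms of the product of \<open>C\<close> and
          \<open>D\<close>; closing by \<open>refl\<close> selects this instance.\<close>
        unfolding stat_algebra_mult linear_ext_linear_ext by (subst linear_ext_swap) (rule refl)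
      also have "\<dots> = linear_ext (\<lambda>C. linear_ext (\<lambda>D. linear_ext (\<lambda>G. linear_ext (?P C) (?P D G)) w) v) u"
        using uvw[THEN carrierD] class_prod_assoc by (intro linear_ext_cong) metis
      also have "\<dots> = u \<otimes>\<^bsub>?A\<^esub> (v \<otimes>\<^bsub>?A\<^esub> w)"
        unfolding stat_algebra_mult linear_ext_linear_ext ..
      finally show "(u \<otimes>\<^bsub>?A\<^esub> v) \<otimes>\<^bsub>?A\<^esub> w = u \<otimes>\<^bsub>?A\<^esub> (v \<otimes>\<^bsub>?A\<^esub> w)" .
    qed
  qed (simp_all add: abelian_group_axioms stat_algebra_mult stat_algebra_simps linear_ext_add linear_ext_fun_add)
  then show ?thesis
    unfolding assoc_algebra_def using smult_left smult_right module_stat_algebra by blast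
qed

end

section \<open>A criterion for isomorphism\<close>

text \<open>The structure constants of both algebras are the same functions of the sizes. A map that
  preserves value and size and meets every class therefore induces a bijection of classes that
  respects products, and its linear extension is the isomorphism.\<close>

lemma algebra_iso_first_letter_statistics:
  fixes F :: "'a shuffle_family" and G :: "'b shuffle_family"
    and st :: "'a \<Rightarrow> 's" and st' :: "'b \<Rightarrow> 's"
  assumes F: "first_letter_statistic F st" and G: "first_letter_statistic G st'"
    and f: "f \<in> objects F \<rightarrow> objects G"
    and st_f: "\<And>x. x \<in> objects F \<Longrightarrow> st' (f x) = st x"
    and size_f: "\<And>x. x \<in> objects F \<Longrightarrow> obj_size G (f x) = obj_size F x"
    and surj: "\<And>y. y \<in> objects G \<Longrightarrow> \<exists>x\<in>objects F. st x = st' y \<and> obj_size F x = obj_size G y"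
  shows "\<exists>\<phi>\<in>algebra_iso (ring_of_type_algebra :: rat ring) (stat_algebra F st) (stat_algebra G st').
           \<forall>x\<in>objects F. \<phi> (basis_elem F st x) = basis_elem G st' (f x)"
proof -
  interpret F: first_letter_statistic F st by (rule F)
  interpret G: first_letter_statistic G st' by (rule G)
  let ?A = "stat_algebra F st" and ?B = "stat_algebra G st'"
  let ?CF = "st_class F st ` objects F" and ?CG = "st_class G st' ` objects G"
  \<comment> \<open>Any representative serves, since \<open>f\<close> preserves value and
    size.\<close>
  define g where "g C = st_class G st' (f (SOME x. x \<in> C))" for C
  have g: "g (st_class F st x) = st_class G st' (f x)" if x: "x \<in> objects F" for x
  proof -
    have "(SOME y. y \<in> st_class F st x) \<in> st_class F st x"
      by (rule someI[of _ x]) (use x in \<open>simp add: st_class_def\<close>)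
    then show ?thesis
      using x st_f size_f unfolding g_def by (auto simp: st_class_def)
  qed
  have bij: "bij_betw g ?CF ?CG"
  proof (rule bij_betw_imageI)
    show "inj_on g ?CF"
      using f st_f size_f by (auto simp: inj_on_def g st_class_eq_iff Pi_iff)
    have "st_class G st' y \<in> g ` ?CF" if "y \<in> objects G" for y
    proof -
      obtain x where "x \<in> objects F" "st x = st' y" "obj_size F x = obj_size G y"
        using surj \<open>y \<in> objects G\<close> by blast
      then have "st_class G st' y = g (st_class F st x)"
        using that by (simp add: g st_class_eq_iff st_f size_f)
      then show ?thesis
        using \<open>x \<in> objects F\<close> by blast
    qed
    then show "g ` ?CF = ?CG"
      using f by (auto simp: g)
  qed
  define g' where "g' = the_inv_into ?CF g"
  have g': "g' (g C) = C" if "C \<in> ?CF" for C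
    unfolding g'_def using bij that by (intro the_inv_into_f_f) (auto simp: bij_betw_def)
  have gg': "g (g' D) = D" if "D \<in> ?CG" for D
    unfolding g'_def using bij that by (intro f_the_inv_into_f) (auto simp: bij_betw_def)
  have g_in: "g C \<in> ?CG" if "C \<in> ?CF" for C
    using bij_betwE[OF bij] that by (rule bspec)
  have g'_in: "g' D \<in> ?CF" if "D \<in> ?CG" for D
    unfolding g'_def using bij_betwE[OF bij_betw_the_inv_into[OF bij]] that by (rule bspec)
  define \<phi> :: "('a set \<Rightarrow>\<^sub>0 rat) \<Rightarrow> 'b set \<Rightarrow>\<^sub>0 rat"
    where "\<phi> = linear_ext (\<lambda>C. Poly_Mapping.single (g C) 1)"
  define \<psi> :: "('b set \<Rightarrow>\<^sub>0 rat) \<Rightarrow> 'a set \<Rightarrow>\<^sub>0 rat"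
    where "\<psi> = linear_ext (\<lambda>D. Poly_Mapping.single (g' D) 1)"
  have \<phi>_carrier: "\<phi> u \<in> carrier ?B" if "u \<in> carrier ?A" for u
    using that g_in unfolding \<phi>_def stat_algebra_simps mem_Collect_eq
    by (intro keys_linear_ext_subset) (simp add: subset_iff)
  have \<psi>_carrier: "\<psi> u \<in> carrier ?A" if "u \<in> carrier ?B" for u
    using that g'_in unfolding \<psi>_def stat_algebra_simps mem_Collect_eq
    by (intro keys_linear_ext_subset) (simp add: subset_iff)
  have \<psi>\<phi>: "\<psi> (\<phi> u) = u" if "u \<in> carrier ?A" for u
  proof -
    have "\<psi> (\<phi> u) = linear_ext (\<lambda>C. Poly_Mapping.single C 1) u"
      unfolding \<psi>_def \<phi>_def linear_ext_linear_ext
      using that by (intro linear_ext_cong) (auto simp: stat_algebra_simps g')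
    then show ?thesis by simp
  qed
  have \<phi>\<psi>: "\<phi> (\<psi> u) = u" if "u \<in> carrier ?B" for u
  proof -
    have "\<phi> (\<psi> u) = linear_ext (\<lambda>C. Poly_Mapping.single C 1) u"
      unfolding \<psi>_def \<phi>_def linear_ext_linear_ext
      using that by (intro linear_ext_cong) (auto simp: stat_algebra_simps gg')
    then show ?thesis by simp
  qed
  have \<phi>_bij: "bij_betw \<phi> (carrier ?A) (carrier ?B)"
    by (rule bij_betw_byWitness[of _ \<psi>]) (use \<phi>_carrier \<psi>_carrier \<psi>\<phi> \<phi>\<psi> in auto)
  have f_in: "f x \<in> objects G" if "x \<in> objects F" for x
    using f that by blast
  have st_shuffle_f: "image_mset st' (obj_shuffle G (f x) (f y)) = image_mset st (obj_shuffle F x y)"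
    if "x \<in> objects F" "y \<in> objects F" for x y
    using that f_in by (cases "obj_size F x + obj_size F y = 0")
      (simp_all add: F.st_shuffle_zero G.st_shuffle_zero F.st_shuffle G.st_shuffle st_f size_f)
  have \<phi>_class_prod: "\<phi> (class_prod F st C D) = class_prod G st' (g C) (g D)"
    if C: "C \<in> ?CF" and D: "D \<in> ?CF" for C D
  proof -
    obtain x y where xy: "x \<in> objects F" "y \<in> objects F"
      and CD: "C = st_class F st x" "D = st_class F st y"
      using C D by blast
    have "\<phi> (class_prod F st C D) =
        (\<Sum>z\<in>#obj_shuffle F x y. Poly_Mapping.single (g (st_class F st z)) 1)"
      by (simp add: CD F.class_prod_eq[OF xy] \<phi>_def linear_ext_sum_mset multiset.map_comp o_def)
    also have "\<dots> = (\<Sum>z\<in>#obj_shuffle F x y. Poly_Mapping.single (G.cls (st z) (obj_size F x + obj_size F y)) 1)"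
      using F.shuffle_objects[OF xy] F.shuffle_size[OF xy]
      by (intro arg_cong[of _ _ sum_mset] image_mset_cong) (simp add: g st_class_def[of G] st_f size_f)
    also have "\<dots> = class_prod G st' (g C) (g D)"
      using xy f_in
      by (simp add: CD g G.class_prod_values st_shuffle_f size_f multiset.map_comp o_def)
    finally show ?thesis .
  qed
  have "\<phi> \<in> ring_hom ?A ?B"
  proof (rule ring_hom_memI)
    fix u v assume uv: "u \<in> carrier ?A" "v \<in> carrier ?A"
    have "\<phi> (u \<otimes>\<^bsub>?A\<^esub> v) = linear_ext (\<lambda>C. linear_ext (\<lambda>D. \<phi> (class_prod F st C D)) v) u"
      unfolding \<phi>_def stat_algebra_mult linear_ext_linear_ext ..
    also have "\<dots> = linear_ext (\<lambda>C. linear_ext (\<lambda>D. class_prod G st' (g C) (g D)) v) u"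
      using uv by (intro linear_ext_cong \<phi>_class_prod) (auto simp: stat_algebra_simps)
    also have "\<dots> = \<phi> u \<otimes>\<^bsub>?B\<^esub> \<phi> v"
      by (simp add: \<phi>_def stat_algebra_mult linear_ext_linear_ext)
    finally show "\<phi> (u \<otimes>\<^bsub>?A\<^esub> v) = \<phi> u \<otimes>\<^bsub>?B\<^esub> \<phi> v" .
  next
    \<comment> \<open>The image of the empty object has size 0, and all objects of size 0 lie in a
      single class.\<close>
    have "st_class G st' (f (empty_obj F)) = st_class G st' (empty_obj G)"
      by (rule G.st_class_size_zero) (simp_all add: f_in F.empty_obj size_f F.size_empty_obj)
    then show "\<phi> \<one>\<^bsub>?A\<^esub> = \<one>\<^bsub>?B\<^esub>"
      by (simp add: \<phi>_def stat_algebra_simps g F.empty_obj)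
  qed (simp_all add: \<phi>_carrier, simp add: \<phi>_def stat_algebra_simps linear_ext_add)
  then have "\<phi> \<in> algebra_iso ring_of_type_algebra ?A ?B"
    using \<phi>_bij F.assoc_algebra G.assoc_algebra
    by (simp add: algebra_iso_def ring_iso_def) (simp add: \<phi>_def stat_algebra_simps linear_ext_smult)
  moreover have "\<phi> (basis_elem F st x) = basis_elem G st' (f x)" if "x \<in> objects F" for x
    using that by (simp add: \<phi>_def basis_elem_def g)
  ultimately show ?thesis by blast
qed

section \<open>Parking functions\<close>

text \<open>In this form \<open>lel\<close> depends only on the first entry and the multiset of
  entries, and the multiset of a shuffle is the sum of those of its factors. For the empty list the
  unspecified first entry is harmless, as every count is 0.\<close>

lemma lel_eq_count: "lel \<alpha> = count (mset \<alpha>) (\<alpha> ! 0)"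
  unfolding lel_def count_mset count_list_eq_length_filter length_filter_conv_card
  by (simp only: eq_commute)

lemma lel_bounds:
  assumes "\<alpha> \<noteq> []"
  shows "0 < lel \<alpha>" "lel \<alpha> \<le> length \<alpha>"
  unfolding lel_eq_count using assms by (simp_all add: count_mset_gt_0) (simp add: count_mset count_le_length)

lemma parking_function_le_length:
  assumes "\<alpha> \<in> parking_functions" "a \<in> set \<alpha>"
  shows "a \<le> length \<alpha>"
proof -
  have "a \<in> set (sort \<alpha>)" using assms by simp
  then obtain i where "i < length \<alpha>" "a = sort \<alpha> ! i"
    by (metis in_set_conv_nth length_sort)
  then show ?thesis
    using assms unfolding parking_functions_def by fastforce
qed

text \<open>The shift puts every entry of \<beta> above all entries of \<alpha>, so the sorted
  shuffle is a concatenation and the bound can be checked on the two halves.\<close>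

lemma shuffles_parking_function:
  assumes \<alpha>: "\<alpha> \<in> parking_functions" and \<beta>: "\<beta> \<in> parking_functions"
    and \<gamma>: "\<gamma> \<in> shuffles \<alpha> (map (\<lambda>b. b + length \<alpha>) \<beta>)"
  shows "\<gamma> \<in> parking_functions"
proof -
  let ?\<beta>' = "map (\<lambda>b. b + length \<alpha>) (sort \<beta>)"
  have "sort \<gamma> = sort \<alpha> @ ?\<beta>'"
  proof (rule properties_for_sort)
    show "mset (sort \<alpha> @ ?\<beta>') = mset \<gamma>"
      using mset_shuffles[OF \<gamma>] by simp
    have "sorted ?\<beta>'"
      by (simp add: sorted_map)
    then show "sorted (sort \<alpha> @ ?\<beta>')"
      using parking_function_le_length[OF \<alpha>] by (fastforce simp: sorted_append)
  qed
  moreover have "\<forall>c\<in>set \<gamma>. 1 \<le> c"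
    using set_shuffles[OF \<gamma>] \<alpha> \<beta> by (force simp: parking_functions_def)
  moreover have "(sort \<alpha> @ ?\<beta>') ! i \<le> Suc i" if "i < length \<alpha> + length \<beta>" for i
  proof (cases "i < length \<alpha>")
    case True
    then show ?thesis
      using \<alpha> by (simp add: parking_functions_def nth_append)
  next
    case False
    with that have "sort \<beta> ! (i - length \<alpha>) \<le> Suc (i - length \<alpha>)"
      using \<beta> by (simp add: parking_functions_def)
    with False that show ?thesis
      by (simp add: nth_append)
  qed
  ultimately show ?thesis
    using length_shuffles[OF \<gamma>] by (simp add: parking_functions_def)
qed

text \<open>The first entry is at most the length of its factor, hence below all shifted entries,
  which add nothing to its count.\<close>

lemma lel_Cons_shuffles_left:
  assumes "a # xs \<in> parking_functions" "\<beta> \<in> parking_functions"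
    and "\<gamma> \<in> shuffles xs (map (\<lambda>b. b + length (a # xs)) \<beta>)"
  shows "lel (a # \<gamma>) = lel (a # xs)"
proof -
  have "a \<le> length (a # xs)"
    using assms(1) by (rule parking_function_le_length) simp
  then have "a \<notin> set (map (\<lambda>b. b + length (a # xs)) \<beta>)"
    using assms(2) by (force simp: parking_functions_def)
  then show ?thesis
    unfolding lel_eq_count using mset_shuffles[OF assms(3)] by (simp add: count_eq_zero_iff)
qed

lemma lel_Cons_shuffles_right:
  assumes "\<alpha> \<in> parking_functions" "b # ys \<in> parking_functions"
    and "\<gamma> \<in> shuffles \<alpha> (map (\<lambda>b. b + length \<alpha>) ys)"
  shows "lel ((b + length \<alpha>) # \<gamma>) = lel (b # ys)"
proof -
  have "b + length \<alpha> \<notin> set \<alpha>"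
    using parking_function_le_length[OF assms(1)] assms(2) by (force simp: parking_functions_def)
  moreover have "count (image_mset (\<lambda>b. b + length \<alpha>) (mset ys)) (b + length \<alpha>) = count (mset ys) b"
    by (induction ys) auto
  ultimately show ?thesis
    unfolding lel_eq_count using mset_shuffles[OF assms(3)] by (simp add: count_eq_zero_iff)
qed

lemma lel_shift: "lel (map (\<lambda>b. b + n) \<beta>) = lel \<beta>"
proof -
  have "map (\<lambda>b. b + n) \<beta> ! i = map (\<lambda>b. b + n) \<beta> ! 0 \<longleftrightarrow> \<beta> ! i = \<beta> ! 0" if "i < length \<beta>" for i
    using that by (subst (1 2) nth_map) auto
  then show ?thesis
    by (simp add: lel_def cong: conj_cong)
qed

text \<open>The shuffles are split by the factor that supplies the first entry; that entry decides
  the value, and the tails are counted as shuffles of disjoint words.\<close>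

lemma lel_shuffles:
  assumes \<alpha>: "\<alpha> \<in> parking_functions" and \<beta>: "\<beta> \<in> parking_functions"
    and pos: "length \<alpha> + length \<beta> > 0"
  shows "image_mset lel (shifted_shuffle \<alpha> \<beta>) =
    replicate_mset (length \<alpha> + length \<beta> - 1 choose length \<beta>) (lel \<alpha>) +
    replicate_mset (length \<alpha> + length \<beta> - 1 choose length \<alpha>) (lel \<beta>)"
proof (cases "\<alpha> = [] \<or> \<beta> = []")
  case True
  then show ?thesis
    \<comment> \<open>Here there is a single shuffle: one binomial coefficient is 0 and the other is
      1.\<close>
    using pos by (auto simp: shifted_shuffle_def lel_shift binomial_eq_0)
next
  case False
  then obtain a xs b ys where ab: "\<alpha> = a # xs" "\<beta> = b # ys"
    by (meson neq_Nil_conv)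
  let ?s = "\<lambda>b. b + length \<alpha>"
  let ?L = "shuffles xs (map ?s \<beta>)" and ?R = "shuffles \<alpha> (map ?s ys)"
  have le: "c \<le> length \<alpha>" if "c \<in> set \<alpha>" for c
    using \<alpha> that by (rule parking_function_le_length)
  have ge: "c > length \<alpha>" if "c \<in> set (map ?s \<beta>)" for c
    using \<beta> that by (force simp: parking_functions_def)
  have disj: "set \<alpha> \<inter> set (map ?s \<beta>) = {}"
    using le ge by force
  have "card ?L = (length xs + length \<beta> choose length xs)"
    using disj by (subst card_disjoint_shuffles) (auto simp: ab)
  also have "\<dots> = (length \<alpha> + length \<beta> - 1 choose length \<beta>)"
    using binomial_symmetric[of "length xs" "length xs + length \<beta>"] by (simp add: ab)
  finally have L: "card ((#) a ` ?L) = (length \<alpha> + length \<beta> - 1 choose length \<beta>)"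
    by (simp add: card_image)
  have "card ?R = (length \<alpha> + length ys choose length \<alpha>)"
    using disj by (subst card_disjoint_shuffles) (auto simp: ab)
  then have R: "card ((#) (?s b) ` ?R) = (length \<alpha> + length \<beta> - 1 choose length \<alpha>)"
    by (simp add: card_image ab)
  \<comment> \<open>Different first letters make the two families disjoint, so
    \<open>mset_set\<close> of their union is a sum.\<close>
  have "a \<noteq> ?s b"
    using disj by (auto simp: ab)
  then have "mset_set (shuffles \<alpha> (map ?s \<beta>)) = mset_set ((#) a ` ?L) + mset_set ((#) (?s b) ` ?R)"
    unfolding ab by (subst mset_set_Union[symmetric]) auto
  moreover have "image_mset lel (mset_set ((#) a ` ?L)) = replicate_mset (card ((#) a ` ?L)) (lel \<alpha>)"
    by (rule image_mset_set_const) (use \<alpha> \<beta> lel_Cons_shuffles_left[of a xs \<beta>] in \<open>auto simp: ab(1)\<close>)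
  moreover have "image_mset lel (mset_set ((#) (?s b) ` ?R)) = replicate_mset (card ((#) (?s b) ` ?R)) (lel \<beta>)"
    by (rule image_mset_set_const) (use \<alpha> \<beta> lel_Cons_shuffles_right[of \<alpha> b ys] in \<open>auto simp: ab(2)\<close>)
  ultimately show ?thesis
    unfolding shifted_shuffle_def by (simp only: image_mset_union L R)
qed

lemma first_letter_statistic_lel: "first_letter_statistic PF lel"
proof
  show "empty_obj PF \<in> objects PF"
    by (simp add: PF_def parking_functions_def)
next
  fix x y assume "x \<in> objects PF" "y \<in> objects PF" "0 < obj_size PF x + obj_size PF y"
  then show "image_mset lel (obj_shuffle PF x y) =
      replicate_mset (obj_size PF x + obj_size PF y - 1 choose obj_size PF y) (lel x) +
      replicate_mset (obj_size PF x + obj_size PF y - 1 choose obj_size PF x) (lel y)"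
    using lel_shuffles[of x y] by (simp add: PF_def)
qed (auto simp: PF_def shifted_shuffle_def length_shuffles intro: shuffles_parking_function)

section \<open>Set partitions\<close>

lemma partition_on_Un:
  assumes "partition_on A P" "partition_on B Q" "A \<inter> B = {}"
  shows "partition_on (A \<union> B) (P \<union> Q)"
proof (rule partition_onI)
  note AB = partition_onD1[OF assms(1)] partition_onD1[OF assms(2)]
  show "\<Union>(P \<union> Q) = A \<union> B"
    by (simp add: AB)
  show "{} \<notin> P \<union> Q"
    using assms by (auto dest: partition_onD3)
  fix p q assume pq: "p \<in> P \<union> Q" "q \<in> P \<union> Q" "p \<noteq> q"
  consider "p \<in> P" "q \<in> P" | "p \<in> Q" "q \<in> Q" | "p \<subseteq> A" "q \<subseteq> B" | "p \<subseteq> B" "q \<subseteq> A"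
    using pq unfolding AB by blast
  then show "disjnt p q"
    by cases (use pq assms in \<open>auto simp: disjnt_def dest!: partition_onD2 dest: disjointD\<close>)
qed

lemma sp_size_eq: "partition_on {1..n} \<pi> \<Longrightarrow> sp_size \<pi> = n"
  by (simp add: sp_size_def flip: partition_onD1)

lemma in_set_partitions_iff: "\<pi> \<in> set_partitions \<longleftrightarrow> partition_on {1..sp_size \<pi>} \<pi>"
  using sp_size_eq by (auto simp: set_partitions_def)

lemma bk1_eq:
  assumes "partition_on A \<pi>" "B \<in> \<pi>" "1 \<in> B"
  shows "bk1 \<pi> = card B"
proof -
  have "(THE C. C \<in> \<pi> \<and> 1 \<in> C) = B"
    using assms by (intro the_equality) (auto simp: partition_on_def disjoint_def)
  then show ?thesis using assms(2) by (auto simp: bk1_def)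
qed

lemma bk1_bounds:
  assumes "partition_on {1..n} \<pi>" "n > 0"
  shows "0 < bk1 \<pi>" "bk1 \<pi> \<le> n"
proof -
  have "1 \<in> \<Union>\<pi>"
    using assms partition_onD1[OF assms(1)] by auto
  then obtain B where B: "B \<in> \<pi>" "1 \<in> B" by blast
  then have "B \<subseteq> {1..n}"
    using partition_onD1[OF assms(1)] by blast
  then have "finite B" "card B \<le> n"
    using finite_subset card_mono[of "{1..n}" B] by auto
  then show "0 < bk1 \<pi>" "bk1 \<pi> \<le> n"
    using B by (auto simp: bk1_eq[OF assms(1) B] card_gt_0_iff)
qed

text \<open>On \<open>{1..n}\<close> exactly \<open>i - 1\<close> elements lie below
  \<open>i\<close>, so the relabelling is the increasing enumeration of \<open>S\<close>, counted
  from 1.\<close>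

lemma shift_eq:
  assumes "partition_on {1..n} \<pi>"
  shows "shift S \<pi> = (`) (\<lambda>i. sorted_list_of_set S ! (i - 1)) ` \<pi>"
  unfolding shift_def
proof (intro image_cong refl)
  fix B i assume "B \<in> \<pi>" "i \<in> B"
  then have "i \<in> {1..n}"
    using partition_onD1[OF assms] by blast
  then have "{j \<in> \<Union>\<pi>. j < i} = {1..<i}"
    by (auto simp flip: partition_onD1[OF assms])
  then show "sorted_list_of_set S ! card {j \<in> \<Union>\<pi>. j < i} = sorted_list_of_set S ! (i - 1)"
    by simp
qed

lemma bij_betw_nth_sorted_list_of_set:
  assumes "finite S" "card S = n"
  shows "bij_betw (\<lambda>i. sorted_list_of_set S ! (i - 1)) {1..n} S"
proof -
  have "bij_betw (\<lambda>i. i - 1) {1..n} {..<n}"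
    by (rule bij_betw_byWitness[of _ Suc]) auto
  moreover have "bij_betw ((!) (sorted_list_of_set S)) {..<n} S"
    using assms by (intro bij_betw_nth) auto
  ultimately show ?thesis
    using bij_betw_trans by (fastforce simp: o_def)
qed

lemma partition_on_shift:
  assumes "partition_on {1..n} \<pi>" "finite S" "card S = n"
  shows "partition_on S (shift S \<pi>)"
proof -
  let ?g = "\<lambda>i. sorted_list_of_set S ! (i - 1)"
  have "partition_on (?g ` {1..n}) ((`) ?g ` \<pi> - {{}})"
    using assms bij_betw_nth_sorted_list_of_set[OF assms(2,3)]
    by (intro partition_on_inj_image) (auto simp: bij_betw_def)
  \<comment> \<open>\<open>partition_on_inj_image\<close> removes the empty set from the image, but
    no block is empty.\<close>
  moreover have "{} \<notin> (`) ?g ` \<pi>"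
    using partition_onD3[OF assms(1)] by auto
  ultimately show ?thesis
    using bij_betw_nth_sorted_list_of_set[OF assms(2,3)]
    by (simp add: shift_eq[OF assms(1)] bij_betw_def)
qed

text \<open>The increasing enumeration of \<open>S\<close> maps 1 to the minimum of
  \<open>S\<close>, which is again 1 as 0 is excluded. So the block of 1 is mapped injectively onto
  the block of 1.\<close>

lemma bk1_shift_Un:
  assumes \<pi>: "partition_on {1..n} \<pi>" and S: "finite S" "card S = n" "1 \<in> S" "0 \<notin> S"
    and part: "partition_on A (shift S \<pi> \<union> P)"
  shows "bk1 (shift S \<pi> \<union> P) = bk1 \<pi>"
proof -
  let ?g = "\<lambda>i. sorted_list_of_set S ! (i - 1)"
  have "n > 0" using S(1-3) card_gt_0_iff[of S] by auto
  then have "1 \<in> \<Union>\<pi>"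
    using partition_onD1[OF \<pi>] by auto
  then obtain B where B: "B \<in> \<pi>" "1 \<in> B" by blast
  have "B \<subseteq> {1..n}"
    using B partition_onD1[OF \<pi>] by blast
  then have "inj_on ?g B"
    using bij_betw_nth_sorted_list_of_set[OF S(1,2)] by (auto simp: bij_betw_def intro: inj_on_subset)
  have "Min S = 1"
    using S by (intro Min_eqI) (auto simp: Suc_le_eq intro: gr0I)
  then have "?g 1 = 1"
    using S by (subst sorted_list_of_set_nonempty) auto
  then have "1 \<in> ?g ` B"
    using B(2) by force
  then have "bk1 (shift S \<pi> \<union> P) = card (?g ` B)"
    using B(1) by (intro bk1_eq[OF part]) (auto simp: shift_eq[OF \<pi>])
  also have "\<dots> = bk1 \<pi>"
    using \<open>inj_on ?g B\<close> by (simp add: card_image bk1_eq[OF \<pi> B])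
  finally show ?thesis .
qed

lemma partition_on_arc_shuffle:
  assumes "partition_on {1..n} \<tau>" "partition_on {1..m} \<theta>" "S \<subseteq> {1..n + m}" "card S = n"
  shows "partition_on {1..n + m} (shift S \<tau> \<union> shift ({1..n + m} - S) \<theta>)"
proof -
  have "finite S" using finite_subset[OF assms(3)] by simp
  moreover have "card ({1..n + m} - S) = m"
    using assms \<open>finite S\<close> by (simp add: card_Diff_subset)
  ultimately have "partition_on (S \<union> ({1..n + m} - S)) (shift S \<tau> \<union> shift ({1..n + m} - S) \<theta>)"
    using assms by (intro partition_on_Un partition_on_shift) auto
  moreover have "S \<union> ({1..n + m} - S) = {1..n + m}"
    using assms by blast
  ultimately show ?thesis by simp
qed

text \<open>The index sets \<open>S\<close> are split by whether they contain 1, that is, by the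
  factor whose relabelled blocks cover 1.\<close>

lemma bk1_arc_shuffle:
  assumes \<tau>: "partition_on {1..n} \<tau>" and \<theta>: "partition_on {1..m} \<theta>" and pos: "n + m > 0"
  shows "image_mset bk1 (arc_shuffle \<tau> \<theta>) =
    replicate_mset (n + m - 1 choose m) (bk1 \<tau>) + replicate_mset (n + m - 1 choose n) (bk1 \<theta>)"
proof -
  let ?U = "{1..n + m}"
  let ?h = "\<lambda>S. shift S \<tau> \<union> shift (?U - S) \<theta>"
  define L where "L = {S. S \<subseteq> ?U \<and> card S = n \<and> 1 \<in> S}"
  define R where "R = {S. S \<subseteq> ?U \<and> card S = n \<and> 1 \<notin> S}"
  have all: "{S. S \<subseteq> ?U \<and> card S = n} = L \<union> R" and disj: "L \<inter> R = {}"
    by (auto simp: L_def R_def)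
  have fin: "finite L" "finite R"
    by (auto simp: L_def R_def)
  have "R = {S. S \<subseteq> {2..n + m} \<and> card S = n}"
  proof -
    have "{2..n + m} = ?U - {1}" by auto
    then show ?thesis by (auto simp: R_def)
  qed
  then have R: "card R = (n + m - 1 choose n)"
    by (simp add: n_subsets)
  \<comment> \<open>The sets containing 1 are counted as the difference from all subsets of size
    \<open>n\<close>, with \<open>choose_pred_add\<close>.\<close>
  have "card (L \<union> R) = (n + m choose n)"
    using n_subsets[of ?U n] unfolding all by simp
  then have "card L + card R = (n + m choose n)"
    by (simp add: card_Un_disjoint[OF fin disj])
  then have L: "card L = (n + m - 1 choose m)"
    using choose_pred_add[OF pos] R by simp
  have "image_mset bk1 (arc_shuffle \<tau> \<theta>) = image_mset (bk1 \<circ> ?h) (mset_set (L \<union> R))"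
    unfolding arc_shuffle_def sp_size_eq[OF \<tau>] sp_size_eq[OF \<theta>] Let_def all
    by (simp add: multiset.map_comp)
  also have "\<dots> = image_mset (bk1 \<circ> ?h) (mset_set L) + image_mset (bk1 \<circ> ?h) (mset_set R)"
    by (simp add: mset_set_Union[OF fin disj])
  also have "image_mset (bk1 \<circ> ?h) (mset_set L) = replicate_mset (card L) (bk1 \<tau>)"
  proof (rule image_mset_set_const)
    fix S assume S: "S \<in> L"
    then have "finite S" "0 \<notin> S"
      using finite_subset by (auto simp: L_def)
    moreover have "partition_on ?U (?h S)"
      using S by (intro partition_on_arc_shuffle[OF \<tau> \<theta>]) (auto simp: L_def)
    ultimately show "(bk1 \<circ> ?h) S = bk1 \<tau>"
      using S bk1_shift_Un[OF \<tau>] by (simp add: L_def)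
  qed
  also have "image_mset (bk1 \<circ> ?h) (mset_set R) = replicate_mset (card R) (bk1 \<theta>)"
  proof (rule image_mset_set_const)
    fix S assume S: "S \<in> R"
    then have "finite S"
      using finite_subset by (auto simp: R_def)
    then have "card (?U - S) = m" "1 \<in> ?U - S"
      using S pos by (auto simp: R_def card_Diff_subset)
    \<comment> \<open>The union is commuted to put the factor that owns 1 in front, as in
      \<open>bk1_shift_Un\<close>.\<close>
    moreover have "partition_on ?U (shift (?U - S) \<theta> \<union> shift S \<tau>)"
      using S partition_on_arc_shuffle[OF \<tau> \<theta>, of S] by (simp add: R_def Un_commute)
    ultimately have "bk1 (shift (?U - S) \<theta> \<union> shift S \<tau>) = bk1 \<theta>"
      by (intro bk1_shift_Un[OF \<theta>]) auto
    then show "(bk1 \<circ> ?h) S = bk1 \<theta>"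
      by (simp add: Un_commute)
  qed
  finally show ?thesis
    by (simp add: L R)
qed

lemma first_letter_statistic_bk1: "first_letter_statistic SP bk1"
proof
  show "empty_obj SP \<in> objects SP"
    using partition_on_empty[of "{}"] by (simp add: SP_def in_set_partitions_iff sp_size_def)
  show "obj_size SP (empty_obj SP) = 0"
    by (simp add: SP_def sp_size_def)
next
  fix x assume "x \<in> objects SP" "obj_size SP x = 0"
  then show "bk1 x = bk1 (empty_obj SP)"
    by (simp add: SP_def in_set_partitions_iff partition_on_empty)
next
  fix x y z assume xy: "x \<in> objects SP" "y \<in> objects SP" and z: "z \<in># obj_shuffle SP x y"
  then have "partition_on {1..sp_size x} x" "partition_on {1..sp_size y} y"
    by (simp_all add: SP_def in_set_partitions_iff)
  moreover obtain S where "S \<subseteq> {1..sp_size x + sp_size y}" "card S = sp_size x"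
    and "z = shift S x \<union> shift ({1..sp_size x + sp_size y} - S) y"
    using z by (auto simp: SP_def arc_shuffle_def Let_def)
  ultimately have "partition_on {1..sp_size x + sp_size y} z"
    using partition_on_arc_shuffle by blast
  then show "z \<in> objects SP" "obj_size SP z = obj_size SP x + obj_size SP y"
    by (auto simp: SP_def set_partitions_def sp_size_eq)
next
  fix x y assume "x \<in> objects SP" "y \<in> objects SP" "obj_size SP x + obj_size SP y = 0"
  then have "x = {}" "y = {}"
    by (simp_all add: SP_def in_set_partitions_iff partition_on_empty)
  moreover have "{S :: nat set. S = {} \<and> card S = 0} = {{}}"
    by auto
  ultimately show "image_mset bk1 (obj_shuffle SP x y) = {#bk1 x#}"
    by (simp add: SP_def arc_shuffle_def sp_size_def shift_def)
next
  fix x y assume "x \<in> objects SP" "y \<in> objects SP" "0 < obj_size SP x + obj_size SP y"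
  then show "image_mset bk1 (obj_shuffle SP x y) =
      replicate_mset (obj_size SP x + obj_size SP y - 1 choose obj_size SP y) (bk1 x) +
      replicate_mset (obj_size SP x + obj_size SP y - 1 choose obj_size SP x) (bk1 y)"
    by (simp add: SP_def in_set_partitions_iff bk1_arc_shuffle)
qed

section \<open>The map from set partitions to parking functions\<close>

text \<open>This makes the truncated subtraction in \<open>sp_to_pf\<close> exact, so that the map
  preserves size.\<close>

lemma bk1_le_sp_size:
  assumes "\<pi> \<in> set_partitions"
  shows "bk1 \<pi> \<le> sp_size \<pi>"
proof (cases "sp_size \<pi> = 0")
  case True
  with assms show ?thesis
    by (simp add: in_set_partitions_iff partition_on_empty bk1_def)
next
  case False
  with assms show ?thesis
    by (simp add: in_set_partitions_iff bk1_bounds)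
qed

lemma bk1_pos: "\<pi> \<in> set_partitions \<Longrightarrow> sp_size \<pi> > 0 \<Longrightarrow> bk1 \<pi> > 0"
  by (simp add: in_set_partitions_iff bk1_bounds)

lemma length_sp_to_pf: "\<pi> \<in> set_partitions \<Longrightarrow> length (sp_to_pf \<pi>) = sp_size \<pi>"
  using bk1_le_sp_size by (simp add: sp_to_pf_def)

lemma sp_to_pf_parking_function:
  assumes "\<pi> \<in> set_partitions"
  shows "sp_to_pf \<pi> \<in> parking_functions"
proof -
  have "sorted (sp_to_pf \<pi>)"
    by (simp add: sp_to_pf_def sorted_append)
  then have "sort (sp_to_pf \<pi>) = sp_to_pf \<pi>"
    by (rule sorted_sort_id)
  moreover have "sp_to_pf \<pi> ! i \<le> Suc i" if "i < length (sp_to_pf \<pi>)" for i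
    \<comment> \<open>Only the position 0 is critical: an entry 2 is forbidden there, and
      \<open>bk1_pos\<close> makes the first entry 1.\<close>
    using that bk1_pos[OF assms] length_sp_to_pf[OF assms]
    by (cases i) (auto simp: sp_to_pf_def nth_append)
  ultimately show ?thesis
    by (auto simp: parking_functions_def) (auto simp: sp_to_pf_def)
qed

lemma lel_sp_to_pf:
  assumes "\<pi> \<in> set_partitions"
  shows "lel (sp_to_pf \<pi>) = bk1 \<pi>"
proof (cases "sp_size \<pi> = 0")
  case True
  with bk1_le_sp_size[OF assms] show ?thesis
    by (simp add: sp_to_pf_def lel_def)
next
  case False
  with bk1_pos[OF assms] show ?thesis
    by (simp add: lel_eq_count sp_to_pf_def nth_append)
qed

text \<open>Gives every possible value of \<open>lel\<close> on nonempty parking functions a set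
  partition of the same size, for the surjectivity on classes.\<close>

lemma ex_set_partition_bk1:
  assumes "0 < k" "k \<le> n"
  shows "\<exists>\<pi>\<in>set_partitions. bk1 \<pi> = k \<and> sp_size \<pi> = n"
proof -
  \<comment> \<open>The remaining elements form one block, left out for \<open>k = n\<close> because
    blocks are nonempty.\<close>
  define Q where "Q = (if k < n then {{k<..n}} else {})"
  have "partition_on {k<..n} Q"
    by (simp add: Q_def partition_on_space partition_on_empty)
  then have "partition_on ({1..k} \<union> {k<..n}) ({{1..k}} \<union> Q)"
    using assms by (intro partition_on_Un partition_on_space) auto
  moreover have "{1..k} \<union> {k<..n} = {1..n}"
    using assms by auto
  ultimately have part: "partition_on {1..n} ({{1..k}} \<union> Q)"
    by (simp only:)
  moreover from this have "bk1 ({{1..k}} \<union> Q) = card {1..k}"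
    by (rule bk1_eq) (use assms in auto)
  ultimately show ?thesis
    by (intro bexI[of _ "{{1..k}} \<union> Q"]) (simp_all only: sp_size_eq in_set_partitions_iff card_atLeastAtMost, simp)
qed

theorem proposition5p11:
  shows "weakly_shuffle_compatible SP bk1 \<and>
         sp_to_pf \<in> objects SP \<rightarrow> objects PF \<and>
         (\<exists>\<phi> \<in> algebra_iso (ring_of_type_algebra :: rat ring) (stat_algebra SP bk1) (stat_algebra PF lel).
            \<forall>\<pi>\<in>objects SP. \<phi> (basis_elem SP bk1 \<pi>) = basis_elem PF lel (sp_to_pf \<pi>))"
proof (intro conjI)
  show "weakly_shuffle_compatible SP bk1"
    by (rule first_letter_statistic.compatible[OF first_letter_statistic_bk1])
  show f: "sp_to_pf \<in> objects SP \<rightarrow> objects PF"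
    by (simp add: SP_def PF_def sp_to_pf_parking_function)
  show "\<exists>\<phi> \<in> algebra_iso (ring_of_type_algebra :: rat ring) (stat_algebra SP bk1) (stat_algebra PF lel).
      \<forall>\<pi>\<in>objects SP. \<phi> (basis_elem SP bk1 \<pi>) = basis_elem PF lel (sp_to_pf \<pi>)"
  proof (rule algebra_iso_first_letter_statistics[OF first_letter_statistic_bk1
        first_letter_statistic_lel f])
    fix \<alpha> assume "\<alpha> \<in> objects PF"
    show "\<exists>\<pi>\<in>objects SP. bk1 \<pi> = lel \<alpha> \<and> obj_size SP \<pi> = obj_size PF \<alpha>"
    \<comment> \<open>The value 0 occurs only in size 0, where the empty partition is the witness;
      otherwise \<open>lel_bounds\<close> puts the value in the range of
      \<open>ex_set_partition_bk1\<close>.\<close>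
    proof (cases "\<alpha> = []")
      case True
      have "{} \<in> set_partitions"
        using partition_on_empty[of "{}"] by (simp add: in_set_partitions_iff sp_size_def)
      with True show ?thesis
        by (intro bexI[of _ "{}"]) (auto simp: SP_def PF_def bk1_def lel_def sp_size_def)
    next
      case False
      then show ?thesis
        using ex_set_partition_bk1[OF lel_bounds] by (simp add: SP_def PF_def)
    qed
  qed (simp_all add: SP_def PF_def lel_sp_to_pf length_sp_to_pf)
qed

end
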